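(* Let $K$ be a field with $\operatorname{char}(K)\neq 2$, let $m,n$ be positive integers, and let $P$ be an $n\times m$ matrix over $K$. Let $\mathfrak{M}(m,n,P)$ be the associative $K$-algebra whose underlying vector space is the space ${\rm M}_{m\times n}(K)$ of $m\times n$ matrices over $K$, with multiplication $A\cdot B=APB$. Then every commuting map of $\mathfrak{M}(m,n,P)$ is standard.
   Context: For an associative (not necessarily unital) $K$-algebra $\mathcal{A}$, with product $xy$, put $[x,y]=xy-yx$ and let $Z(\mathcal{A})$ be its center; for $\mathfrak{M}(m,n,P)$ the product used is $\cdot$. A $K$-linear map $\theta:\mathcal{A}\to\mathcal{A}$ is commuting if $[\theta(x),x]=0$ for all $x\in\mathcal{A}$. A commuting map $\theta$ is standard if there are $c\in K$, $\lambda\in Z(\mathcal{A})$ and a $K$-linear map $\mu:\mathcal{A}\to\mathcal{A}$ with range in $Z(\mathcal{A})$ such that $\theta(x)=cx+\lambda x+\mu(x)$ for all $x\in\mathcal{A}$ (where $\lambda x$ is the product in $\mathcal{A}$). *)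

theory Defs
  imports "HOL-Analysis.Analysis"
begin

locale assoc_algebra = vector_space scale
  for scale :: "'k::field \<Rightarrow> 'v::ab_group_add \<Rightarrow> 'v" +
  fixes mul :: "'v \<Rightarrow> 'v \<Rightarrow> 'v"
  assumes mul_assoc: "mul (mul x y) z = mul x (mul y z)"
    and mul_add_left: "mul (x + y) z = mul x z + mul y z"
    and mul_add_right: "mul x (y + z) = mul x y + mul x z"
    and mul_scale_left: "mul (scale c x) y = scale c (mul x y)"
    and mul_scale_right: "mul x (scale c y) = scale c (mul x y)"
begin

definition commutator :: "'v \<Rightarrow> 'v \<Rightarrow> 'v" where
  "commutator x y = mul x y - mul y x"

definition center :: "'v set" where
  "center = {z. \<forall>x. commutator z x = 0}"

definition commuting_map :: "('v \<Rightarrow> 'v) \<Rightarrow> bool" where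
  "commuting_map \<theta> \<longleftrightarrow>
     Vector_Spaces.linear scale scale \<theta> \<and> (\<forall>x. commutator (\<theta> x) x = 0)"

definition standard_map :: "('v \<Rightarrow> 'v) \<Rightarrow> bool" where
  "standard_map \<theta> \<longleftrightarrow>
     (\<exists>c. \<exists>l\<in>center. \<exists>\<mu>. Vector_Spaces.linear scale scale \<mu> \<and> range \<mu> \<subseteq> center \<and>
        (\<forall>x. \<theta> x = scale c x + mul l x + \<mu> x))"

end

text \<open>
  An \<open>m \<times> n\<close> matrix over \<open>K\<close> has type \<open>K ^ 'n ^ 'm\<close> (the row index is the outer one),
  so an \<open>n \<times> m\<close> matrix \<open>P\<close> has type \<open>K ^ 'm ^ 'n\<close>. The library's scaling of vectors
  \<open>c *s x\<close> does not apply to matrices, as it takes \<open>c\<close> from the type of the entries of \<open>x\<close>.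
\<close>

definition matrix_scale :: "'k::field \<Rightarrow> 'k ^ 'n ^ 'm \<Rightarrow> 'k ^ 'n ^ 'm" where
  "matrix_scale c = map_matrix (\<lambda>a. c * a)"

definition munn_mult ::
  "'k::field ^ 'm ^ 'n \<Rightarrow> 'k ^ 'n ^ 'm \<Rightarrow> 'k ^ 'n ^ 'm \<Rightarrow> 'k ^ 'n ^ 'm" where
  "munn_mult P A B = A ** P ** B"

lemma matrix_scale_mult_left: "matrix_scale c A ** B = matrix_scale c (A ** B)"
  by (simp add: matrix_scale_def matrix_matrix_mult_def vec_eq_iff sum_distrib_left mult.assoc)

lemma matrix_scale_mult_right: "A ** matrix_scale c B = matrix_scale c (A ** B)"
  by (simp add: matrix_scale_def matrix_matrix_mult_def vec_eq_iff sum_distrib_left mult.left_commute)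

lemma matrix_mult_add_left:
  fixes A B :: "'k::field ^ 'n ^ 'm"
  shows "(A + B) ** C = A ** C + B ** C"
  by (simp add: matrix_matrix_mult_def vec_eq_iff distrib_right sum.distrib)

lemma assoc_algebra_munn:
  fixes P :: "'k::field ^ 'm ^ 'n"
  shows "assoc_algebra matrix_scale (munn_mult P)"
proof unfold_locales
qed (simp_all add: munn_mult_def matrix_mul_assoc matrix_mult_add_left matrix_add_ldistrib
       matrix_scale_mult_left matrix_scale_mult_right,
     simp_all add: matrix_scale_def vec_eq_iff algebra_simps)

end

(* For a commuting map theta, D(x,y) = [theta x, y] is a biderivation, so D(x,y) z [u,v] =
   [x,y] z D(u,v) for all z. If P [u,v] P is nonzero for some u, v, letting z run over the matrix
   units yields one scalar c with D(x,y) P = c [x,y] P and P D(x,y) = c P [x,y], and this makes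
   theta x - c x central. Otherwise P has rank at most one; if P is nonzero, then
   P x P = alpha(x) P for a linear form alpha, and linearizing [S x, x] = 0 at an e with P e P = P,
   where S x = theta x - alpha(theta e) x, gives alpha(S x) [e, x] = 0. So S is central-valued
   or e, and then the whole algebra, is central. *)

theory Submission
  imports Defs
begin

section \<open>Commuting maps and biderivations in an associative algebra\<close>

context assoc_algebra
begin

lemma mul_zero_left [simp]: "mul 0 x = 0"
  using mul_add_left[of 0 0 x] by simp

lemma mul_zero_right [simp]: "mul x 0 = 0"
  using mul_add_right[of x 0 0] by simp

lemma mul_diff_left: "mul (x - y) z = mul x z - mul y z"
  using mul_add_left[of "x - y" y z] by (simp add: algebra_simps)

lemma mul_diff_right: "mul x (y - z) = mul x y - mul x z"
  using mul_add_right[of x "y - z" z] by (simp add: algebra_simps)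

lemma commutator_mul_right:
  "commutator x (mul y z) = mul y (commutator x z) + mul (commutator x y) z"
  by (simp add: commutator_def mul_diff_left mul_diff_right mul_assoc)

lemma commutator_mul_left:
  "commutator (mul x y) z = mul x (commutator y z) + mul (commutator x z) y"
  by (simp add: commutator_def mul_diff_left mul_diff_right mul_assoc)

lemma zero_in_center: "0 \<in> center"
  by (simp add: center_def commutator_def)

lemma commuting_mapD:
  assumes "commuting_map \<theta>"
  shows "mul (\<theta> x) x = mul x (\<theta> x)"
  using assms by (simp add: commuting_map_def commutator_def)

lemma commuting_map_linearized:
  assumes "commuting_map \<theta>"
  shows "mul (\<theta> x) y + mul (\<theta> y) x = mul x (\<theta> y) + mul y (\<theta> x)"
proof -
  interpret T: Vector_Spaces.linear scale scale \<theta>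
    using assms by (simp add: commuting_map_def)
  show ?thesis
    using commuting_mapD[OF assms, of "x + y"] commuting_mapD[OF assms, of x]
      commuting_mapD[OF assms, of y]
    by (simp add: T.add mul_add_left mul_add_right algebra_simps)
qed

lemma commuting_map_diff_scale:
  assumes "commuting_map \<theta>"
  shows "commuting_map (\<lambda>x. \<theta> x - scale c x)"
proof -
  have "Vector_Spaces.linear scale scale (\<lambda>x. \<theta> x - scale c x)"
    using assms linear_scale_self
    by (auto simp: commuting_map_def intro!: vector_space_pair.linear_compose_sub
        vector_space_pair.intro vector_space_axioms)
  then show ?thesis
    using commuting_mapD[OF assms]
    by (simp add: commuting_map_def commutator_def mul_diff_left mul_diff_right
        mul_scale_left mul_scale_right)
qed

lemma standard_mapI:
  assumes "commuting_map \<theta>" and "\<And>x. \<theta> x - scale c x \<in> center"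
  shows "standard_map \<theta>"
  unfolding standard_map_def
  using commuting_map_diff_scale[OF assms(1), of c] assms(2) zero_in_center
  by (intro exI[of _ c] bexI[of _ 0] exI[of _ "\<lambda>x. \<theta> x - scale c x"])
     (auto simp: commuting_map_def)

text \<open>Linearization moves \<theta> from one argument of the commutator to the other, so
  \<open>commutator (\<theta> x) y\<close> is a derivation in each argument.\<close>

lemma commutator_commuting_map_swap:
  assumes "commuting_map \<theta>"
  shows "commutator (\<theta> x) y = commutator x (\<theta> y)"
  using commuting_map_linearized[OF assms, of x y]
  by (simp add: commutator_def algebra_simps)

text \<open>Once \<theta> is moved onto \<open>z\<close>, this is the product rule for the
  commutator with the fixed element \<open>\<theta> z\<close>.\<close>

lemma commutator_commuting_map_mul:
  assumes "commuting_map \<theta>"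
  shows "commutator (\<theta> (mul x y)) z
    = mul x (commutator (\<theta> y) z) + mul (commutator (\<theta> x) z) y"
  by (simp add: commutator_commuting_map_swap[OF assms] commutator_mul_left)

text \<open>Compare the two expansions of \<open>D (x u) (y v)\<close> for the biderivation
  \<open>D x y = [\<theta> x, y] = [x, \<theta> y]\<close> (Bresar).\<close>

lemma commuting_map_biderivation:
  assumes "commuting_map \<theta>"
  shows "mul (commutator (\<theta> x) y) (commutator u v) = mul (commutator x y) (commutator (\<theta> u) v)"
proof -
  have "commutator (\<theta> (mul x u)) (mul y v)
      = mul x (mul y (commutator (\<theta> u) v)) + mul x (mul (commutator (\<theta> u) y) v)
      + mul y (mul (commutator (\<theta> x) v) u) + mul (commutator (\<theta> x) y) (mul v u)"
    by (subst commutator_commuting_map_mul[OF assms])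
       (simp add: commutator_mul_right mul_add_left mul_add_right mul_assoc)
  moreover have "commutator (\<theta> (mul x u)) (mul y v)
      = mul y (mul x (commutator (\<theta> u) v)) + mul y (mul (commutator (\<theta> x) v) u)
      + mul x (mul (commutator (\<theta> u) y) v) + mul (commutator (\<theta> x) y) (mul u v)"
    by (subst commutator_mul_right)
       (simp add: commutator_commuting_map_mul[OF assms] mul_add_left mul_add_right mul_assoc)
  ultimately show ?thesis
    by (simp add: commutator_def[of u v] commutator_def[of x y] mul_diff_left mul_diff_right
        mul_assoc algebra_simps)
qed

text \<open>Put \<open>mul z u\<close> for \<open>u\<close> in the identity without a middle factor
  and expand both sides by the product rule; the terms ending in \<open>u\<close> cancel by the same
  identity for \<open>z\<close> and \<open>v\<close>.\<close>

lemma commuting_map_biderivation_middle: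
  assumes "commuting_map \<theta>"
  shows "mul (mul (commutator (\<theta> x) y) z) (commutator u v)
       = mul (mul (commutator x y) z) (commutator (\<theta> u) v)"
proof -
  have "mul (mul (commutator (\<theta> x) y) (commutator z v)) u
      = mul (mul (commutator x y) (commutator (\<theta> z) v)) u"
    by (simp add: commuting_map_biderivation[OF assms])
  then show ?thesis
    using commuting_map_biderivation[OF assms, of x y "mul z u" v]
    by (simp add: commutator_mul_left commutator_commuting_map_mul[OF assms] mul_add_right mul_assoc)
qed

end

section \<open>Matrix identities with a free middle factor\<close>

text \<open>With the matrix unit at \<open>(i, j)\<close> as \<open>Z\<close>, the
  \<open>(a, b)\<close> entry of \<open>X ** Z ** Y\<close> is a single product of entries. Fixing a
  nonzero entry on one side then shows that two matrices are proportional.\<close>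

lemma matrix_sandwich_eqD:
  fixes X X' :: "'k::field ^ 'm ^ 'a" and Y Y' :: "'k ^ 'b ^ 'n"
  assumes "\<And>Z :: 'k ^ 'n ^ 'm. X ** Z ** Y = X' ** Z ** Y'"
  shows "X $ a $ i * Y $ j $ b = X' $ a $ i * Y' $ j $ b"
proof -
  define E :: "'k ^ 'n ^ 'm" where "E = (\<chi> p q. if p = i then if q = j then 1 else 0 else 0)"
  have *: "(U ** E ** V) $ a $ b = U $ a $ i * V $ j $ b"
    for U :: "'k ^ 'm ^ 'a" and V :: "'k ^ 'b ^ 'n"
  proof -
    have "(U ** E) $ a $ q = (if q = j then U $ a $ i else 0)" for q
    proof -
      have "(U ** E) $ a $ q = (\<Sum>p\<in>UNIV. if p = i then U $ a $ p * (if q = j then 1 else 0) else 0)"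
        unfolding matrix_matrix_mult_def E_def
        by (simp only: vec_lambda_beta, rule sum.cong) auto
      then show ?thesis by simp
    qed
    then have "(U ** E ** V) $ a $ b = (\<Sum>q\<in>UNIV. if q = j then U $ a $ i * V $ q $ b else 0)"
      unfolding matrix_matrix_mult_def[of "U ** E"] by (simp only: vec_lambda_beta, intro sum.cong) auto
    then show ?thesis by simp
  qed
  show ?thesis
    using assms[of E] by (simp add: *[symmetric])
qed

lemma matrix_mult_diff_left:
  fixes A B :: "'k::field ^ 'n ^ 'm"
  shows "(A - B) ** C = A ** C - B ** C"
  using matrix_mult_add_left[of "A - B" B C] by (simp add: algebra_simps)

lemma matrix_mult_diff_right:
  fixes B C :: "'k::field ^ 'n ^ 'm"
  shows "A ** (B - C) = A ** B - A ** C"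
  using matrix_add_ldistrib[of A "B - C" C] by (simp add: algebra_simps)

lemma matrix_mult_zero [simp]:
  fixes A :: "'k::field ^ 'n ^ 'm"
  shows "A ** 0 = 0" "0 ** A = 0"
  by (simp_all add: matrix_matrix_mult_def vec_eq_iff)

lemma matrix_scale_nth: "matrix_scale c A $ i $ j = c * A $ i $ j"
  by (simp add: matrix_scale_def)

lemma matrix_scale_simps [simp]:
  "matrix_scale 0 A = 0" "matrix_scale c 0 = 0"
  by (simp_all add: vec_eq_iff matrix_scale_nth)

lemma nonzero_matrix_entryE:
  assumes "A \<noteq> 0"
  obtains i j where "A $ i $ j \<noteq> 0"
  using assms by (auto simp: vec_eq_iff)

section \<open>Center and commutators of the algebra\<close>

lemma munn_center_iff:
  "z \<in> assoc_algebra.center (munn_mult P) \<longleftrightarrow> (\<forall>y. z ** P ** y = y ** P ** z)"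
proof -
  interpret assoc_algebra matrix_scale "munn_mult P"
    by (rule assoc_algebra_munn)
  show ?thesis
    by (simp add: center_def commutator_def munn_mult_def)
qed

lemma munn_commutator:
  "assoc_algebra.commutator (munn_mult P) x y = x ** P ** y - y ** P ** x"
proof -
  interpret assoc_algebra matrix_scale "munn_mult P"
    by (rule assoc_algebra_munn)
  show ?thesis
    by (simp add: commutator_def munn_mult_def)
qed

text \<open>The right condition makes \<open>z ** P\<close> a scalar matrix \<open>s\<close>. If
  \<open>P ** z ** P\<close> vanishes, so do \<open>z ** P\<close> and \<open>P ** z\<close>.
  Otherwise \<open>s\<close> is nonzero, and \<open>s\<close> times a commutator of \<open>z\<close>
  is \<open>z ** P\<close> times it, which is zero by the left condition.\<close>

lemma munn_centralI:
  fixes P :: "'k::field ^ 'm ^ 'n" and z :: "'k ^ 'n ^ 'm"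
  assumes "P \<noteq> 0"
    and left: "\<And>y. P ** (z ** P ** y - y ** P ** z) = 0"
    and right: "\<And>y. (z ** P ** y - y ** P ** z) ** P = 0"
  shows "z \<in> assoc_algebra.center (munn_mult P)"
proof -
  have zP: "(z ** P) $ a $ i * P $ j $ b = (mat 1 :: 'k ^ 'm ^ 'm) $ a $ i * (P ** z ** P) $ j $ b"
    for a i j b
    by (rule matrix_sandwich_eqD)
       (use right in \<open>simp add: matrix_mult_diff_left matrix_mul_assoc\<close>)
  have Pz: "(P ** z ** P) $ a $ i * (mat 1 :: 'k ^ 'n ^ 'n) $ j $ b = P $ a $ i * (P ** z) $ j $ b"
    for a i j b
    by (rule matrix_sandwich_eqD)
       (use left in \<open>simp add: matrix_mult_diff_right matrix_mul_assoc\<close>)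
  have "z ** P ** y = y ** P ** z" for y
  proof (cases "P ** z ** P = 0")
    case True
    obtain j b where "P $ j $ b \<noteq> 0"
      using nonzero_matrix_entryE[OF \<open>P \<noteq> 0\<close>] .
    then have "z ** P = 0" "P ** z = 0"
      using zP[of _ _ j b] Pz[of j b] True by (auto simp: vec_eq_iff)
    then show ?thesis
      by (simp flip: matrix_mul_assoc)
  next
    case False
    then obtain j b where jb: "(P ** z ** P) $ j $ b \<noteq> 0"
      using nonzero_matrix_entryE by metis
    then have "P $ j $ b \<noteq> 0"
      using zP[of b b j b] by (auto simp: mat_def)
    define s where "s = (P ** z ** P) $ j $ b / P $ j $ b"
    have "z ** P = matrix_scale s (mat 1)"
      using zP[of _ _ j b] \<open>P $ j $ b \<noteq> 0\<close>
      by (simp add: vec_eq_iff matrix_scale_nth s_def field_simps)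
    then have "matrix_scale s (z ** P ** y - y ** P ** z) = z ** P ** (z ** P ** y - y ** P ** z)"
      by (simp add: matrix_scale_mult_left)
    also have "\<dots> = 0"
      using left[of y] by (simp flip: matrix_mul_assoc)
    finally show ?thesis
      using jb \<open>P $ j $ b \<noteq> 0\<close> by (simp add: s_def vec_eq_iff matrix_scale_nth)
  qed
  then show ?thesis
    by (simp add: munn_center_iff)
qed

section \<open>The case of a nonzero \<open>P [u, v] P\<close>\<close>

lemma munn_commuting_map_standard_of_commutator:
  fixes P :: "'k::field ^ 'm ^ 'n"
  assumes comm: "assoc_algebra.commuting_map matrix_scale (munn_mult P) \<theta>"
    and nz: "P ** (u ** P ** v - v ** P ** u) ** P \<noteq> 0"
  shows "assoc_algebra.standard_map matrix_scale (munn_mult P) \<theta>"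
proof -
  interpret assoc_algebra matrix_scale "munn_mult P"
    by (rule assoc_algebra_munn)
  let ?W = "P ** commutator u v ** P" and ?D = "P ** commutator (\<theta> u) v ** P"
  have "?W \<noteq> 0"
    using nz by (simp add: munn_commutator)
  then obtain j b where jb: "?W $ j $ b \<noteq> 0"
    using nonzero_matrix_entryE by metis
  \<comment> \<open>The ratio at one nonzero entry of \<open>?W\<close> serves all \<open>x\<close>
    and \<open>y\<close>, and multiplication by \<open>P\<close> on either side.\<close>
  define c where "c = ?D $ j $ b / ?W $ j $ b"
  have D_P: "commutator (\<theta> x) y ** P = matrix_scale c (commutator x y ** P)" for x y
  proof -
    have "(commutator (\<theta> x) y ** P) $ a $ i * ?W $ j $ b = (commutator x y ** P) $ a $ i * ?D $ j $ b"
      for a i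
    proof (rule matrix_sandwich_eqD)
      fix z
      show "commutator (\<theta> x) y ** P ** z ** ?W = commutator x y ** P ** z ** ?D"
        using arg_cong[OF commuting_map_biderivation_middle[OF comm, of x y z u v], of "\<lambda>X. X ** P"]
        by (simp add: munn_mult_def matrix_mul_assoc)
    qed
    then show ?thesis
      using jb by (simp add: vec_eq_iff matrix_scale_nth c_def field_simps)
  qed
  \<comment> \<open>Here \<open>u\<close> and \<open>v\<close> stand on the left of the middle
    factor, and \<open>x\<close> and \<open>y\<close> on the right; the scalar is again
    \<open>c\<close>.\<close>
  have P_D: "P ** commutator (\<theta> x) y = matrix_scale c (P ** commutator x y)" for x y
  proof -
    have "?D $ j $ b * (P ** commutator x y) $ a $ i = ?W $ j $ b * (P ** commutator (\<theta> x) y) $ a $ i"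
      for a i
    proof (rule matrix_sandwich_eqD)
      fix z
      show "?D ** z ** (P ** commutator x y) = ?W ** z ** (P ** commutator (\<theta> x) y)"
        using arg_cong[OF commuting_map_biderivation_middle[OF comm, of u v z x y], of "\<lambda>X. P ** X"]
        by (simp add: munn_mult_def matrix_mul_assoc)
    qed
    then show ?thesis
      using jb by (simp add: vec_eq_iff matrix_scale_nth c_def field_simps)
  qed
  have S: "commutator (\<theta> x - matrix_scale c x) y = commutator (\<theta> x) y - matrix_scale c (commutator x y)"
    for x y
    by (simp add: commutator_def mul_diff_left mul_diff_right mul_scale_left mul_scale_right
        scale_right_diff_distrib)
  have "\<theta> x - matrix_scale c x \<in> center" for x
  proof (rule munn_centralI)
    show "P \<noteq> 0"
      using nz by auto
  next
    fix y
    show "P ** ((\<theta> x - matrix_scale c x) ** P ** y - y ** P ** (\<theta> x - matrix_scale c x)) = 0"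
      unfolding munn_commutator[symmetric] S
      by (simp add: matrix_mult_diff_right matrix_scale_mult_right P_D)
    show "((\<theta> x - matrix_scale c x) ** P ** y - y ** P ** (\<theta> x - matrix_scale c x)) ** P = 0"
      unfolding munn_commutator[symmetric] S
      by (simp add: matrix_mult_diff_left matrix_scale_mult_left D_P)
  qed
  then show ?thesis
    by (rule standard_mapI[OF comm])
qed

section \<open>The case of rank one\<close>

text \<open>Here \<open>P\<close> has rank one, and \<open>\<alpha>\<close> is the trace form \<open>x \<mapsto> tr (x P)\<close>.\<close>

lemma munn_commuting_map_standard_of_rank_one:
  fixes P :: "'k::field ^ 'm ^ 'n"
  assumes comm: "assoc_algebra.commuting_map matrix_scale (munn_mult P) \<theta>"
    and "P \<noteq> 0"
    and eq: "\<And>u v. P ** u ** P ** v ** P = P ** v ** P ** u ** P"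
  shows "assoc_algebra.standard_map matrix_scale (munn_mult P) \<theta>"
proof -
  interpret assoc_algebra matrix_scale "munn_mult P"
    by (rule assoc_algebra_munn)
  obtain j i where ji: "P $ j $ i \<noteq> 0"
    using nonzero_matrix_entryE[OF \<open>P \<noteq> 0\<close>] .
  define \<alpha> where "\<alpha> u = (P ** u ** P) $ j $ i / P $ j $ i" for u
  have PuP: "P ** u ** P = matrix_scale (\<alpha> u) P" for u
  proof -
    \<comment> \<open>The free middle factor is the \<open>v\<close> of the commutation
      hypothesis.\<close>
    have "(P ** u ** P) $ a $ b * P $ j $ i = P $ a $ b * (P ** u ** P) $ j $ i" for a b
      by (rule matrix_sandwich_eqD) (use eq[of u] in \<open>simp add: matrix_mul_assoc\<close>)
    then show ?thesis
      using ji by (simp add: vec_eq_iff matrix_scale_nth \<alpha>_def field_simps)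
  qed
  have "\<exists>z. P ** z ** P \<noteq> 0"
  proof (rule ccontr)
    assume "\<not> ?thesis"
    \<comment> \<open>The matrix unit at \<open>(i, j)\<close> would make the square of this nonzero
      entry vanish.\<close>
    then have "P $ j $ i * P $ j $ i = (0 :: 'k ^ 'm ^ 'n) $ j $ i * P $ j $ i"
      by (intro matrix_sandwich_eqD) simp
    with ji show False
      by simp
  qed
  then obtain z where "P ** z ** P \<noteq> 0" ..
  then have "\<alpha> z \<noteq> 0"
    by (auto simp: PuP)
  \<comment> \<open>Normalized so that \<open>\<alpha> e = 1\<close>: \<open>e\<close> is a
    generalized inverse of \<open>P\<close>, and any factor \<open>P\<close> may be expanded to
    \<open>P ** e ** P\<close>.\<close>
  define e where "e = matrix_scale (1 / \<alpha> z) z"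
  have PeP: "P ** e ** P = P"
    using \<open>\<alpha> z \<noteq> 0\<close>
    by (simp add: e_def matrix_scale_mult_left matrix_scale_mult_right PuP)
       (simp add: vec_eq_iff matrix_scale_nth)
  \<comment> \<open>This choice gives \<open>\<alpha> (S e) = 0\<close>.\<close>
  define c where "c = \<alpha> (\<theta> e)"
  define S where "S x = \<theta> x - matrix_scale c x" for x
  have S: "commuting_map S"
    unfolding S_def by (rule commuting_map_diff_scale[OF comm])
  have lin: "S x ** P ** y + S y ** P ** x = x ** P ** S y + y ** P ** S x" for x y
    using commuting_map_linearized[OF S, of x y] by (simp add: munn_mult_def)
  have "P ** S e ** P = 0"
    by (simp add: S_def matrix_mult_diff_left matrix_mult_diff_right matrix_scale_mult_left
        matrix_scale_mult_right PeP PuP[of "\<theta> e"] c_def)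
  have Se: "S e ** P ** e = e ** P ** S e"
    using commuting_mapD[OF S, of e] by (simp add: munn_mult_def)
  \<comment> \<open>Expanding \<open>P\<close> and moving \<open>e\<close> past \<open>S e\<close>
    produces the factor \<open>P ** S e ** P\<close>, which is zero.\<close>
  have "S e ** P = S e ** (P ** e ** P)"
    by (simp only: PeP)
  also have "\<dots> = e ** (P ** S e ** P)"
    using arg_cong[OF Se, of "\<lambda>X. X ** P"] by (simp add: matrix_mul_assoc)
  finally have SeP: "S e ** P = 0"
    using \<open>P ** S e ** P = 0\<close> by simp
  have "P ** S e = (P ** e ** P) ** S e"
    by (simp only: PeP)
  also have "\<dots> = (P ** S e ** P) ** e"
    using arg_cong[OF Se, of "\<lambda>X. P ** X"] by (simp add: matrix_mul_assoc)
  finally have PSe: "P ** S e = 0"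
    using \<open>P ** S e ** P = 0\<close> by simp
  \<comment> \<open>Both terms containing \<open>S e\<close> drop out of the linearized identity, so
    every \<open>S x\<close> commutes with \<open>e\<close>.\<close>
  have Sxe: "S x ** P ** e = e ** P ** S x" for x
    using lin[of x e] SeP PSe by (simp add: matrix_mul_assoc[of _ P "S e", symmetric])
  have SxP: "S x ** P = matrix_scale (\<alpha> (S x)) (e ** P)" for x
  proof -
    have "S x ** P = S x ** (P ** e ** P)"
      by (simp only: PeP)
    also have "\<dots> = e ** (P ** S x ** P)"
      using arg_cong[OF Sxe, of "\<lambda>X. X ** P"] by (simp add: matrix_mul_assoc)
    finally show ?thesis
      by (simp add: PuP matrix_scale_mult_right)
  qed
  have PSx: "P ** S x = matrix_scale (\<alpha> (S x)) (P ** e)" for x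
  proof -
    have "P ** S x = (P ** e ** P) ** S x"
      by (simp only: PeP)
    also have "\<dots> = (P ** S x ** P) ** e"
      using arg_cong[OF Sxe, of "\<lambda>X. P ** X"] by (simp add: matrix_mul_assoc)
    finally show ?thesis
      by (simp add: PuP matrix_scale_mult_left)
  qed
  \<comment> \<open>In products, \<open>S x\<close> acts like the multiple
    \<open>\<alpha> (S x)\<close> of \<open>e\<close>.\<close>
  have SxPy: "S x ** P ** y = matrix_scale (\<alpha> (S x)) (e ** P ** y)" for x y
    by (simp add: SxP matrix_scale_mult_left)
  have yPSx: "y ** P ** S x = matrix_scale (\<alpha> (S x)) (y ** P ** e)" for x y
    by (simp add: PSx matrix_scale_mult_right flip: matrix_mul_assoc)
  show ?thesis
  proof (cases "\<forall>x. \<alpha> (S x) = 0")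
    case True
    then have "S x \<in> center" for x
      by (simp add: munn_center_iff SxPy yPSx)
    then show ?thesis
      unfolding S_def by (rule standard_mapI[OF comm])
  next
    case False
    then obtain x where x: "\<alpha> (S x) \<noteq> 0"
      by blast
    have "matrix_scale (\<alpha> (S x)) (e ** P ** x) = matrix_scale (\<alpha> (S x)) (x ** P ** e)"
      using commuting_mapD[OF S, of x] by (simp add: munn_mult_def SxPy yPSx)
    then have ex: "e ** P ** x = x ** P ** e"
      using x by (simp add: vec_eq_iff matrix_scale_nth)
    \<comment> \<open>The linearized identity reads
      \<open>\<alpha> (S x) [e, y] + \<alpha> (S y) [e, x] = 0\<close>, and \<open>[e, x]\<close> is
      zero.\<close>
    have e_central: "e ** P ** y = y ** P ** e" for y
      using lin[of x y] x by (simp add: SxPy yPSx ex vec_eq_iff matrix_scale_nth)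
    \<comment> \<open>With \<open>e\<close> central, the argument given for \<open>S x\<close>
      applies to every \<open>y\<close>: it acts like \<open>\<alpha> y\<close> times
      \<open>e\<close>, so the algebra is commutative.\<close>
    have Py: "P ** y = matrix_scale (\<alpha> y) (P ** e)" for y
    proof -
      have "P ** y = (P ** e ** P) ** y"
        by (simp only: PeP)
      also have "\<dots> = (P ** y ** P) ** e"
        using arg_cong[OF e_central, of "\<lambda>X. P ** X"] by (simp add: matrix_mul_assoc)
      finally show ?thesis
        by (simp add: PuP matrix_scale_mult_left)
    qed
    have yP: "y ** P = matrix_scale (\<alpha> y) (e ** P)" for y
    proof -
      have "y ** P = y ** (P ** e ** P)"
        by (simp only: PeP)
      also have "\<dots> = e ** (P ** y ** P)"
        using arg_cong[OF e_central, of "\<lambda>X. X ** P"] by (simp add: matrix_mul_assoc)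
      finally show ?thesis
        by (simp add: PuP matrix_scale_mult_right)
    qed
    have "y ** P ** w = w ** P ** y" for y w
    proof -
      have "y ** P ** w = matrix_scale (\<alpha> w) (y ** P ** e)"
        by (simp add: Py[of w] matrix_scale_mult_right flip: matrix_mul_assoc)
      also have "\<dots> = w ** P ** y"
        by (simp add: yP[of w] matrix_scale_mult_left e_central)
      finally show ?thesis .
    qed
    then have "w \<in> center" for w
      by (simp add: munn_center_iff)
    then show ?thesis
      by (rule standard_mapI[OF comm])
  qed
qed

section \<open>Assembling the cases\<close>

theorem mainTheorem2:
  fixes P :: "'k::field ^ 'm ^ 'n"
    and \<theta> :: "'k ^ 'n ^ 'm \<Rightarrow> 'k ^ 'n ^ 'm"
  assumes "CHAR('k) \<noteq> 2"
    and "assoc_algebra.commuting_map matrix_scale (munn_mult P) \<theta>"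
  shows "assoc_algebra.standard_map matrix_scale (munn_mult P) \<theta>"
proof (cases "P = 0")
  case True
  \<comment> \<open>For \<open>P = 0\<close> all products vanish, so every element is
    central.\<close>
  then have "x \<in> assoc_algebra.center (munn_mult P)" for x
    by (simp add: munn_center_iff)
  then show ?thesis
    by (rule assoc_algebra.standard_mapI[OF assoc_algebra_munn assms(2)])
next
  case False
  show ?thesis
  proof (cases "\<exists>u v. P ** (u ** P ** v - v ** P ** u) ** P \<noteq> 0")
    case True
    then show ?thesis
      using munn_commuting_map_standard_of_commutator[OF assms(2)] by blast
  next
    case commute: False
    have "P ** u ** P ** v ** P = P ** v ** P ** u ** P" for u v
      using commute
      by (simp add: matrix_mult_diff_left matrix_mult_diff_right matrix_mul_assoc)
    then show ?thesis
      by (rule munn_commuting_map_standard_of_rank_one[OF assms(2) False])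
  qed
qed

end
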